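(* Let $d>1$ and suppose $p,q$ are mixture of Gaussian distributions on $\mathbb{R}^d$ of the form \[p(z)=\sum_{i=1}^{r_p} w_p^i\,\mathcal{N}(z;\mu_p^i,\Sigma_p),\qquad q(z)=\sum_{j=1}^{r_q} w_q^j\,\mathcal{N}(z;\mu_q^j,\Sigma_q).\] If a flow $f$ composed of finitely many ReLU Sylvester flows on $\mathbb{R}^d$ satisfies $p=f\#q$, then almost every point $x\in\mathbb{R}^d$ has an open neighbourhood $\Gamma_x$ such that, for $z\in\Gamma_x$, \[\begin{aligned} &\frac{\sum_{i,j=1}^{r_p}w_p^i\,\mathcal{N}(Az+b;\mu_p^i,\Sigma_p)\,\mathcal{N}(Az+b;\mu_p^j,\Sigma_p)\,A^{\top}\Sigma_p^{-1}\mu_p^i(\mu_p^i-\mu_p^j)^{\top}\Sigma_p^{-1}A}{\left(\sum_{j=1}^{r_p}w_p^j\,\mathcal{N}(Az+b;\mu_p^j,\Sigma_p)\right)^2}\\ &-\frac{\sum_{i,j=1}^{r_q}w_q^i\,\mathcal{N}(z;\mu_q^i,\Sigma_q)\,\mathcal{N}(z;\mu_q^j,\Sigma_q)\,\Sigma_q^{-1}\mu_q^i(\mu_q^i-\mu_q^j)^{\top}\Sigma_q^{-1}}{\left(\sum_{j=1}^{r_q}w_q^j\,\mathcal{N}(z;\mu_q^j,\Sigma_q)\right)^2} \end{aligned}\] is a constant function of $z$ on $\Gamma_x$ for some $A\in\mathbb{R}^{d\times d}$ and $b\in\mathbb{R}^d$.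
   Context: $\mathcal{N}(x;\mu,\Sigma)=\exp\left(-\tfrac12(x-\mu)^{\top}\Sigma^{-1}(x-\mu)\right)/\left((2\pi)^{d/2}\sqrt{\det\Sigma}\right)$ is the Gaussian density on $\mathbb{R}^d$ with mean $\mu$ and covariance $\Sigma$; the $w_p^i$ and $w_q^j$ are the mixture weights (positive, summing to 1 for each of $p$ and $q$). A normalizing flow on $\mathbb{R}^d$ is an invertible function $f:\mathbb{R}^d\to\mathbb{R}^d$ that is differentiable almost everywhere with $\det J_f(z)\neq0$ for almost every $z$, where $J_f$ is the Jacobian matrix. If $z$ has density $q$, then $f\#q$ denotes the density of $f(z)$, given by $(f\#q)(f(z))=q(z)/|\det J_f(z)|$; equality of densities is almost everywhere. A ReLU Sylvester flow on $\mathbb{R}^d$ is a normalizing flow of the form $f(z)=z+A_0\,\mathrm{ReLU}(B_0^{\top}z+b_0)$ with $m<d$, $A_0,B_0\in\mathbb{R}^{d\times m}$, $b_0\in\mathbb{R}^m$, where $\mathrm{ReLU}(x)=\max(x,0)$ is applied coordinate-wise.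
   Formalization: The numerators carry the products of weights w^i w^j where the printed formula has only w^i; as printed the claim is false (e.g. Σ_p=Σ_q=I, weights 1/3, 2/3, q with means e_1, 0, p its translate by e_1). *)

theory Defs
  imports "HOL-Analysis.Analysis"
begin

definition covariance_matrix :: "real^'d^'d \<Rightarrow> bool" where
  "covariance_matrix S \<longleftrightarrow> transpose S = S \<and> (\<forall>x. x \<noteq> 0 \<longrightarrow> x \<bullet> (S *v x) > 0)"

definition gaussian_density :: "real^'d \<Rightarrow> real^'d^'d \<Rightarrow> real^'d \<Rightarrow> real" where
  "gaussian_density \<mu> S x =
     exp (- (1/2) * ((x - \<mu>) \<bullet> (matrix_inv S *v (x - \<mu>)))) /
     ((2 * pi) powr (real CARD('d) / 2) * sqrt (det S))"

definition mixture_weights :: "nat \<Rightarrow> (nat \<Rightarrow> real) \<Rightarrow> bool" where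
  "mixture_weights r w \<longleftrightarrow> (\<forall>i\<in>{1..r}. w i > 0) \<and> (\<Sum>i=1..r. w i) = 1"

definition mixture_density ::
    "nat \<Rightarrow> (nat \<Rightarrow> real) \<Rightarrow> (nat \<Rightarrow> real^'d) \<Rightarrow> real^'d^'d \<Rightarrow> real^'d \<Rightarrow> real" where
  "mixture_density r w \<mu> S z = (\<Sum>i=1..r. w i * gaussian_density (\<mu> i) S z)"

definition normalizing_flow :: "(real^'d \<Rightarrow> real^'d) \<Rightarrow> bool" where
  "normalizing_flow f \<longleftrightarrow> bij f \<and>
     (AE z in lborel. f differentiable (at z)) \<and>
     (AE z in lborel. det (jacobian f (at z)) \<noteq> 0)"

(* The density f#q of f(z) for z with density q: (f#q)(f z) = q z / |det J_f(z)|.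
   The value is only meaningful for almost every argument. *)
definition pushforward_density ::
    "(real^'d \<Rightarrow> real^'d) \<Rightarrow> (real^'d \<Rightarrow> real) \<Rightarrow> real^'d \<Rightarrow> real" where
  "pushforward_density f q x = q (inv f x) / \<bar>det (jacobian f (at (inv f x)))\<bar>"

definition relu :: "real \<Rightarrow> real" where
  "relu t = max t 0"

(* The d x m matrices A and B are given by their columns A k and B k, k < m, so that
   (B^T z + b)_k = B k \<bullet> z + b k; different flows on the same space may have different m. *)
definition relu_sylvester_map ::
    "nat \<Rightarrow> (nat \<Rightarrow> real^'d) \<Rightarrow> (nat \<Rightarrow> real^'d) \<Rightarrow> (nat \<Rightarrow> real) \<Rightarrow> real^'d \<Rightarrow> real^'d" where
  "relu_sylvester_map m A B b z = z + (\<Sum>k<m. relu (B k \<bullet> z + b k) *\<^sub>R A k)"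

definition relu_sylvester_flow :: "(real^'d \<Rightarrow> real^'d) \<Rightarrow> bool" where
  "relu_sylvester_flow f \<longleftrightarrow> normalizing_flow f \<and>
     (\<exists>m A B b. m < CARD('d) \<and> f = relu_sylvester_map m A B b)"

(* u v^T.  The library's columnvector u ** rowvector v leaves the inner dimension,
   hence a scalar factor, undetermined.
   In this notation the Hessian of ln (mixture_density r w \<mu> S) at z is
     - S^-1 + (SUM i j. w_i w_j N_i N_j S^-1 \<mu>_i (\<mu>_i - \<mu>_j)^T S^-1) / (SUM j. w_j N_j)^2,
   where N_i is gaussian_density (\<mu> i) S z. *)
definition outer_product :: "real^'d \<Rightarrow> real^'d \<Rightarrow> real^'d^'d" where
  "outer_product u v = (\<chi> i j. u $ i * v $ j)"

end

theory Submission
  imports Defs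
begin

text \<open>
  A composition of ReLU Sylvester flows is injective and, off a null set, locally of the form
  \<open>z \<mapsto> A z + b\<close>; injectivity makes each such \<open>A\<close> invertible. Locally the densities then satisfy
  \<open>p (A z + b) = q z / \<bar>det A\<bar>\<close>, first almost everywhere and hence, by continuity, everywhere.
  The logarithmic derivative of a Gaussian mixture with common covariance \<open>S\<close> is
  \<open>S\<^sup>-\<^sup>1 (m z - z)\<close>, where \<open>m z\<close> is the mean of the centres under the posterior weights of the
  components at \<open>z\<close>, and the derivative of \<open>m\<close> is \<open>C z S\<^sup>-\<^sup>1\<close>, where \<open>C z\<close> is the posterior
  covariance of the centres. Differentiating the logarithm of the density identity twice
  therefore shows that the expression in question equals \<open>A\<^sup>T \<Sigma>\<^sub>p\<^sup>-\<^sup>1 A - \<Sigma>\<^sub>q\<^sup>-\<^sup>1\<close>.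
\<close>

section \<open>Null sets and locally affine maps\<close>

text \<open>\<open>negligible\<close> refers to the completion of \<open>lborel\<close>, and
  completing a measure does not change which properties hold almost everywhere; so \<open>P\<close>
  may be arbitrary.\<close>

lemma AE_lborel_iff_negligible:
  "(AE x in lborel. P x) \<longleftrightarrow> negligible {x :: 'a::euclidean_space. \<not> P x}"
proof -
  have "(AE x in lborel. P x) \<longleftrightarrow> (\<exists>N. negligible N \<and> {x. \<not> P x} \<subseteq> N)"
    unfolding eventually_ae_filter_negligible[symmetric] by (rule AE_completion_iff[symmetric])
  also have "\<dots> \<longleftrightarrow> negligible {x. \<not> P x}"
    using negligible_subset by blast
  finally show ?thesis .
qed

definition affine_near :: "(real^'n \<Rightarrow> real^'m) \<Rightarrow> real^'n \<Rightarrow> bool" where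
  "affine_near f x \<longleftrightarrow>
     (\<exists>A b \<Gamma>. open \<Gamma> \<and> x \<in> \<Gamma> \<and> (\<forall>z\<in>\<Gamma>. f z = A *v z + b))"

lemma affine_near_eventually:
  "affine_near f x \<longleftrightarrow> (\<exists>A b. eventually (\<lambda>z. f z = A *v z + b) (nhds x))"
  unfolding affine_near_def eventually_nhds by blast

text \<open>A nonzero kernel vector of \<open>A\<close>, scaled to stay inside \<Gamma>, would give
  two points with the same image.\<close>

lemma injective_affine_imp_invertible:
  fixes A :: "real^'n^'n"
  assumes "inj f" "open \<Gamma>" "x \<in> \<Gamma>" and f: "\<And>z. z \<in> \<Gamma> \<Longrightarrow> f z = A *v z + b"
  shows "invertible A"
proof -
  obtain e where e: "e > 0" "ball x e \<subseteq> \<Gamma>"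
    using openE[OF assms(2,3)] by blast
  have "u = 0" if u: "A *v u = 0" for u
  proof (rule ccontr)
    assume "u \<noteq> 0"
    \<comment> \<open>The scaled vector has norm \<open>e / 2\<close>, so the shifted point stays in
      the ball.\<close>
    define c where "c = e / (2 * norm u)"
    have "c > 0" using e \<open>u \<noteq> 0\<close> by (simp add: c_def)
    have "norm (c *\<^sub>R u) < e" using e \<open>u \<noteq> 0\<close> by (simp add: c_def)
    then have "x + c *\<^sub>R u \<in> \<Gamma>" using e by (auto simp: dist_norm)
    then have "f (x + c *\<^sub>R u) = f x"
      using f \<open>x \<in> \<Gamma>\<close> u by (simp add: matrix_vector_right_distrib matrix_vector_mult_scaleR)
    then have "x + c *\<^sub>R u = x"
      by (rule injD[OF \<open>inj f\<close>])
    then show False using \<open>c > 0\<close> \<open>u \<noteq> 0\<close> by simp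
  qed
  then show ?thesis
    by (simp add: invertible_left_inverse matrix_left_invertible_ker)
qed

text \<open>The preimage is contained in the image of \<open>N\<close> under the inverse affine map,
  and differentiable maps send null sets to null sets.\<close>

lemma negligible_vimage_affine:
  fixes A :: "real^'n^'n"
  assumes "invertible A" "negligible N"
  shows "negligible ((\<lambda>z. A *v z + b) -` N)"
proof -
  obtain B where B: "B ** A = mat 1"
    using assms(1) invertible_left_inverse by blast
  have eq: "B *v (A *v z + b - b) = z" for z
    by (simp add: B matrix_vector_mul_assoc)
  have "(\<lambda>z. A *v z + b) -` N \<subseteq> (\<lambda>y. B *v (y - b)) ` N"
  proof
    fix z assume "z \<in> (\<lambda>z. A *v z + b) -` N"
    then show "z \<in> (\<lambda>y. B *v (y - b)) ` N"
      using eq[of z] by (intro image_eqI[of _ _ "A *v z + b"]) auto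
  qed
  moreover have "negligible ((\<lambda>y. B *v (y - b)) ` N)"
  proof (rule negligible_differentiable_image_negligible[OF order_refl assms(2)])
    have "((\<lambda>y. B *v (y - b)) has_derivative (\<lambda>y. B *v y)) (at x within N)" for x
      using bounded_linear.has_derivative[OF matrix_vector_mul_bounded_linear has_derivative_diff[OF has_derivative_ident has_derivative_const]]
      by simp
    then show "(\<lambda>y. B *v (y - b)) differentiable_on N"
      unfolding differentiable_on_def differentiable_def by blast
  qed
  ultimately show ?thesis by (rule negligible_subset[rotated])
qed

text \<open>Injectivity makes every local matrix invertible, so the preimage is null near each point
  of local affinity, and a locally null set is null. This pulls exceptional sets back, both for
  composing flows and for reading the density identity at \<open>f z\<close>.\<close>

lemma negligible_vimage_affine_near:
  fixes f :: "real^'n \<Rightarrow> real^'n"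
  assumes "inj f" "AE x in lborel. affine_near f x" "negligible N"
  shows "negligible (f -` N)"
proof -
  let ?G = "f -` N \<inter> {x. affine_near f x}"
  have "negligible ?G"
  proof (rule locally_negligible_alt[THEN iffD2], rule ballI)
    fix x assume x: "x \<in> ?G"
    then have "affine_near f x" by simp
    then obtain A b \<Gamma> where \<Gamma>: "open \<Gamma>" "x \<in> \<Gamma>" and f: "\<And>z. z \<in> \<Gamma> \<Longrightarrow> f z = A *v z + b"
      unfolding affine_near_def by (elim exE conjE) (metis (no_types))
    have "invertible A"
      using injective_affine_imp_invertible[OF \<open>inj f\<close> \<Gamma> f] .
    moreover have "?G \<inter> \<Gamma> \<subseteq> (\<lambda>z. A *v z + b) -` N"
      using f by auto
    ultimately have "negligible (?G \<inter> \<Gamma>)"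
      by (rule negligible_subset[OF negligible_vimage_affine[OF _ assms(3)]])
    then show "\<exists>U. openin (top_of_set ?G) U \<and> x \<in> U \<and> negligible U"
      using x \<Gamma> openin_open_Int[OF \<Gamma>(1), of ?G] by blast
  qed
  moreover have "f -` N \<subseteq> ?G \<union> {x. \<not> affine_near f x}" by auto
  ultimately show ?thesis
    using assms(2)[unfolded AE_lborel_iff_negligible] by (meson negligible_Un negligible_subset)
qed

lemma affine_near_comp:
  assumes "affine_near h x" "affine_near g (h x)"
  shows "affine_near (g \<circ> h) x"
proof -
  obtain A b C c where h: "\<forall>\<^sub>F z in nhds x. h z = A *v z + b"
    and g: "\<forall>\<^sub>F y in nhds (h x). g y = C *v y + c"
    using assms unfolding affine_near_eventually by blast
  have hx: "h x = A *v x + b"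
    using h by (rule eventually_nhds_x_imp_x)
  \<comment> \<open>Near \<open>x\<close> the map \<open>h\<close> agrees with a continuous affine
    map, so the neighbourhood of \<open>h x\<close> on which \<open>g\<close> is affine pulls back
    to a neighbourhood of \<open>x\<close>.\<close>
  have "isCont (\<lambda>z. A *v z + b) x"
    by (intro continuous_intros linear_continuous_at matrix_vector_mul_bounded_linear)
  then have "filterlim (\<lambda>z. A *v z + b) (nhds (h x)) (nhds x)"
    unfolding hx isCont_def by (rule tendsto_at_iff_tendsto_nhds[THEN iffD1])
  then have "\<forall>\<^sub>F z in nhds x. g (A *v z + b) = C *v (A *v z + b) + c"
    by (rule eventually_compose_filterlim[OF g])
  with h have "\<forall>\<^sub>F z in nhds x. (g \<circ> h) z = (C ** A) *v z + (C *v b + c)"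
    by eventually_elim (simp add: matrix_vector_right_distrib matrix_vector_mul_assoc add.assoc)
  then show ?thesis
    unfolding affine_near_eventually by blast
qed

text \<open>Local affinity can fail only where it fails for \<open>h\<close> or where
  \<open>h\<close> hits the exceptional set of \<open>g\<close>; the latter preimage is
  null.\<close>

lemma AE_affine_near_comp:
  fixes g h :: "real^'n \<Rightarrow> real^'n"
  assumes "inj h" "AE x in lborel. affine_near h x" "AE x in lborel. affine_near g x"
  shows "AE x in lborel. affine_near (g \<circ> h) x"
proof -
  have "negligible (h -` {y. \<not> affine_near g y})"
    by (rule negligible_vimage_affine_near[OF assms(1,2) assms(3)[unfolded AE_lborel_iff_negligible]])
  then have "AE x in lborel. affine_near g (h x)"
    unfolding AE_lborel_iff_negligible by (simp add: vimage_def)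
  with assms(2) show ?thesis
    by eventually_elim (rule affine_near_comp)
qed

section \<open>Local affinity of ReLU Sylvester flows\<close>

text \<open>The assumption keeps \<open>x\<close> off every kink hyperplane. Each pre-activation
  then keeps its sign near \<open>x\<close> or is constant, so the set of active units does not
  change there.\<close>

lemma affine_near_relu_sylvester_map:
  assumes "\<And>k. k < m \<Longrightarrow> B k \<bullet> x + b k = 0 \<Longrightarrow> B k = 0"
  shows "affine_near (relu_sylvester_map m A B b) x"
proof -
  \<comment> \<open>The units active at \<open>x\<close>.\<close>
  define K where "K = {k. k < m \<and> B k \<bullet> x + b k > 0}"
  have "\<forall>\<^sub>F z in nhds x. relu (B k \<bullet> z + b k) = (if k \<in> K then B k \<bullet> z + b k else 0)"
    if k: "k < m" for k
  proof -
    have lim: "((\<lambda>z. B k \<bullet> z + b k) \<longlongrightarrow> B k \<bullet> x + b k) (nhds x)"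
      by (intro tendsto_intros filterlim_ident)
    \<comment> \<open>In the third case the pre-activation vanishes at \<open>x\<close> and has
      \<open>B k = 0\<close>, hence is identically zero.\<close>
    consider "B k \<bullet> x + b k > 0" | "B k \<bullet> x + b k < 0" | "B k = 0" "b k = 0"
      using assms[OF k] by (cases "B k \<bullet> x + b k" "0 :: real" rule: linorder_cases) auto
    then show ?thesis
    proof cases
      case 1
      then show ?thesis
        using order_tendstoD(1)[OF lim 1] k
        by (auto elim!: eventually_mono simp: K_def relu_def)
    next
      case 2
      then show ?thesis
        using order_tendstoD(2)[OF lim 2]
        by (auto elim!: eventually_mono simp: K_def relu_def)
    next
      case 3
      then show ?thesis by (simp add: relu_def)
    qed
  qed
  then have "\<forall>\<^sub>F z in nhds x. \<forall>k\<in>{..<m}. relu (B k \<bullet> z + b k) = (if k \<in> K then B k \<bullet> z + b k else 0)"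
    by (intro eventually_ball_finite) auto
  \<comment> \<open>The identity plus the rank-one terms \<open>A k\<close> times the transpose of
    \<open>B k\<close>, taken over the active units.\<close>
  moreover define M where "M = matrix (\<lambda>z. z + (\<Sum>k\<in>K. (B k \<bullet> z) *\<^sub>R A k))"
  have "linear (\<lambda>z. z + (\<Sum>k\<in>K. (B k \<bullet> z) *\<^sub>R A k))"
    by (intro linear_compose_add linear_ident linear_compose_sum ballI
        bounded_linear.linear bounded_linear_intros)
  then have M: "M *v z = z + (\<Sum>k\<in>K. (B k \<bullet> z) *\<^sub>R A k)" for z
    unfolding M_def by (simp add: matrix_works)
  have "(\<Sum>k<m. (if k \<in> K then B k \<bullet> z + b k else 0) *\<^sub>R A k)
      = (\<Sum>k\<in>K. (B k \<bullet> z + b k) *\<^sub>R A k)" for z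
    by (rule sum.mono_neutral_cong_right) (auto simp: K_def)
  ultimately have "\<forall>\<^sub>F z in nhds x. relu_sylvester_map m A B b z = M *v z + (\<Sum>k\<in>K. b k *\<^sub>R A k)"
    by (auto elim!: eventually_mono simp: relu_sylvester_map_def M sum.distrib algebra_simps)
  then show ?thesis
    unfolding affine_near_eventually by blast
qed

text \<open>The exceptional points lie on the finitely many hyperplanes with
  \<open>B k \<noteq> 0\<close>, each of which is null.\<close>

lemma AE_affine_near_relu_sylvester_map:
  "AE x in lborel. affine_near (relu_sylvester_map m A B b) x"
proof -
  have "negligible (\<Union>k\<in>{k. k < m \<and> B k \<noteq> 0}. {x. B k \<bullet> x = - b k})"
    by (intro negligible_Union) (auto intro: negligible_hyperplane)
  moreover have "{x. \<not> affine_near (relu_sylvester_map m A B b) x}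
      \<subseteq> (\<Union>k\<in>{k. k < m \<and> B k \<noteq> 0}. {x. B k \<bullet> x = - b k})"
    using affine_near_relu_sylvester_map[of m B _ b A] by (fastforce simp: eq_neg_iff_add_eq_0)
  ultimately show ?thesis
    unfolding AE_lborel_iff_negligible by (rule negligible_subset)
qed

text \<open>Bijectivity is carried through the induction because pulling back the exceptional set of
  the outer map \<open>g\<close> requires the inner composite to be injective.\<close>

lemma relu_sylvester_flows_bij_affine_near:
  fixes fs :: "(real^'n \<Rightarrow> real^'n) list"
  assumes "\<forall>g\<in>set fs. relu_sylvester_flow g"
  shows "bij (foldr (\<circ>) fs id) \<and> (AE x in lborel. affine_near (foldr (\<circ>) fs id) x)"
  using assms
proof (induction fs)
  case Nil
  have "affine_near (id :: real^'n \<Rightarrow> real^'n) x" for x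
    unfolding affine_near_eventually
    by (rule exI[of _ "mat 1"], rule exI[of _ 0]) simp
  then have "AE x in lborel. affine_near (id :: real^'n \<Rightarrow> real^'n) x"
    by (rule AE_I2)
  moreover have "foldr (\<circ>) [] id = (id :: real^'n \<Rightarrow> real^'n)"
    by (simp add: fun_eq_iff)
  ultimately show ?case
    using bij_id by (simp only:)
next
  case (Cons g fs)
  then obtain m A B b where g: "bij g" "g = relu_sylvester_map m A B b"
    unfolding relu_sylvester_flow_def normalizing_flow_def by (meson list.set_intros(1))
  moreover have "bij (foldr (\<circ>) fs id)" "AE x in lborel. affine_near (foldr (\<circ>) fs id) x"
    using Cons.IH Cons.prems by (meson list.set_intros(2))+
  moreover have "foldr (\<circ>) (g # fs) id = g \<circ> foldr (\<circ>) fs id"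
    by (simp add: fun_eq_iff)
  ultimately show ?case
    using AE_affine_near_relu_sylvester_map[of m A B b, folded g(2)] g(1)
    by (metis AE_affine_near_comp bij_comp bij_is_inj)
qed

section \<open>Continuous functions that agree almost everywhere\<close>

text \<open>The set where two continuous functions differ on an open set is open, and a nonempty
  open set is not null.\<close>

lemma continuous_eq_off_negligible:
  fixes g h :: "'a::euclidean_space \<Rightarrow> real"
  assumes "open S" "continuous_on S g" "continuous_on S h"
    and "negligible {x\<in>S. g x \<noteq> h x}" "x \<in> S"
  shows "g x = h x"
proof (rule ccontr)
  assume "g x \<noteq> h x"
  have "open (S \<inter> (\<lambda>x. g x - h x) -` (- {0}))"
    by (intro continuous_open_preimage continuous_on_diff assms) auto
  moreover have "S \<inter> (\<lambda>x. g x - h x) -` (- {0}) = {x\<in>S. g x \<noteq> h x}" by auto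
  ultimately have "open {x\<in>S. g x \<noteq> h x}" by simp
  moreover have "{x\<in>S. g x \<noteq> h x} \<noteq> {}"
    using assms(5) \<open>g x \<noteq> h x\<close> by blast
  ultimately show False
    using open_not_negligible assms(4) by blast
qed

section \<open>Covariance matrices and Gaussian densities\<close>

lemma matrix_inv_inverse:
  fixes S :: "real^'n^'n"
  assumes "invertible S"
  shows "S ** matrix_inv S = mat 1" "matrix_inv S ** S = mat 1"
  using someI_ex[OF assms[unfolded invertible_def]] unfolding matrix_inv_def by simp_all

text \<open>Positive definiteness leaves no nonzero vector in the kernel.\<close>

lemma covariance_matrix_imp_invertible:
  assumes "covariance_matrix S"
  shows "invertible S"
  using assms unfolding covariance_matrix_def invertible_left_inverse matrix_left_invertible_ker
  by (metis inner_zero_right less_irrefl)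

text \<open>By symmetry of \<open>S\<close> the transposed inverse is a left inverse of
  \<open>S\<close>, and such an inverse is unique.\<close>

lemma covariance_matrix_imp_transpose_inv:
  assumes "covariance_matrix S"
  shows "transpose (matrix_inv S) = matrix_inv S"
proof -
  note inv = matrix_inv_inverse[OF covariance_matrix_imp_invertible[OF assms]]
  have "transpose (matrix_inv S) ** S = transpose (S ** matrix_inv S)"
    using assms by (simp add: matrix_transpose_mul covariance_matrix_def)
  then have "transpose (matrix_inv S) ** S = mat 1"
    by (simp add: inv transpose_mat)
  then show ?thesis
    by (metis inv(1) matrix_mul_assoc matrix_mul_lid matrix_mul_rid)
qed

lemma inner_matrix_symmetric:
  fixes M :: "real^'n^'n"
  assumes "transpose M = M"
  shows "(M *v x) \<bullet> y = x \<bullet> (M *v y)"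
  by (metis assms dot_lmul_matrix vector_transpose_matrix)

lemma gaussian_density_has_derivative:
  fixes S :: "real^'d^'d"
  assumes "covariance_matrix S"
  shows "(gaussian_density \<mu> S has_derivative
    (\<lambda>u. gaussian_density \<mu> S z * ((\<mu> - z) \<bullet> (matrix_inv S *v u)))) (at z)"
proof -
  let ?M = "matrix_inv S"
  define c where "c = inverse ((2 * pi) powr (real CARD('d) / 2) * sqrt (det S))"
  have g: "gaussian_density \<mu> S = (\<lambda>x. c * exp (- (1/2) * ((x - \<mu>) \<bullet> (?M *v (x - \<mu>)))))"
    unfolding gaussian_density_def c_def divide_inverse by (rule ext) (rule mult.commute)
  have lin: "((\<lambda>x. x - \<mu>) has_derivative (\<lambda>u. u)) (at z)"
    by (auto intro!: derivative_eq_intros)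
  have "((\<lambda>x. ?M *v (x - \<mu>)) has_derivative (\<lambda>u. ?M *v u)) (at z)"
    using bounded_linear.has_derivative[OF matrix_vector_mul_bounded_linear lin] .
  note d = has_derivative_inner[OF lin this]
  \<comment> \<open>Symmetry merges the two terms of the product rule for the quadratic form, which
    produces the factor 2.\<close>
  have sym: "x \<bullet> (?M *v y) = y \<bullet> (?M *v x)" for x y
    by (subst inner_matrix_symmetric[OF covariance_matrix_imp_transpose_inv[OF assms], symmetric])
      (rule inner_commute)
  have d': "((\<lambda>x. (x - \<mu>) \<bullet> (?M *v (x - \<mu>))) has_derivative (\<lambda>u. 2 * ((z - \<mu>) \<bullet> (?M *v u)))) (at z)"
    by (rule has_derivative_eq_rhs[OF d]) (simp add: fun_eq_iff sym[of _ "z - \<mu>"])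
  have "((\<lambda>x. c * exp (- (1/2) * ((x - \<mu>) \<bullet> (?M *v (x - \<mu>))))) has_derivative
      (\<lambda>u. c * (- (1/2) * (2 * ((z - \<mu>) \<bullet> (?M *v u))) * exp (- (1/2) * ((z - \<mu>) \<bullet> (?M *v (z - \<mu>))))))) (at z)"
    by (intro has_derivative_mult_right has_derivative_exp d')
  then show ?thesis
    unfolding g by (rule has_derivative_eq_rhs) (simp add: fun_eq_iff inner_diff_left algebra_simps)
qed

text \<open>
  The normalizing constant is only shown to be nonzero, so that positivity of \<open>det S\<close> is not
  needed; logarithmic derivatives are insensitive to its sign.
\<close>

lemma gaussian_density_sign:
  fixes S :: "real^'d^'d"
  assumes "covariance_matrix S"
  obtains c where "c \<noteq> 0" "\<And>\<mu> z. c * gaussian_density \<mu> S z > 0"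
proof
  let ?c = "(2 * pi) powr (real CARD('d) / 2) * sqrt (det S)"
  show nz: "?c \<noteq> 0"
    using covariance_matrix_imp_invertible[OF assms] invertible_det_nz[of S] by simp
  then show "?c * gaussian_density \<mu> S z > 0" for \<mu> z
    by (simp add: gaussian_density_def)
qed

section \<open>Mixture densities and posterior moments of the centres\<close>

text \<open>A common factor makes every component positive. The sum is nonempty because the weights
  add up to 1.\<close>

lemma mixture_density_nonzero:
  assumes "covariance_matrix S" "mixture_weights r w"
  shows "mixture_density r w \<mu> S z \<noteq> 0"
proof -
  obtain c where c: "\<And>\<mu> z. c * gaussian_density \<mu> S z > 0"
    using gaussian_density_sign[OF assms(1)] by metis
  have "{1..r} \<noteq> {}"
    using assms(2) unfolding mixture_weights_def by (metis sum.empty zero_neq_one)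
  then have "(\<Sum>i=1..r. w i * (c * gaussian_density (\<mu> i) S z)) > 0"
    using assms(2) c by (intro sum_pos) (auto simp: mixture_weights_def)
  then have "c * mixture_density r w \<mu> S z > 0"
    by (simp add: mixture_density_def sum_distrib_left mult.left_commute)
  then show ?thesis by auto
qed

text \<open>
  Mean and covariance of the centres under the weights \<open>w\<^sub>i N\<^sub>i z / (\<Sum>j. w\<^sub>j N\<^sub>j z)\<close>.
\<close>

definition mixture_mean ::
    "nat \<Rightarrow> (nat \<Rightarrow> real) \<Rightarrow> (nat \<Rightarrow> real^'d) \<Rightarrow> real^'d^'d \<Rightarrow> real^'d \<Rightarrow> real^'d" where
  "mixture_mean r w \<mu> S z =
     (\<Sum>i=1..r. (w i * gaussian_density (\<mu> i) S z) *\<^sub>R \<mu> i) /\<^sub>R mixture_density r w \<mu> S z"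

definition mixture_covariance ::
    "nat \<Rightarrow> (nat \<Rightarrow> real) \<Rightarrow> (nat \<Rightarrow> real^'d) \<Rightarrow> real^'d^'d \<Rightarrow> real^'d \<Rightarrow> real^'d^'d" where
  "mixture_covariance r w \<mu> S z =
     (\<Sum>i=1..r. \<Sum>j=1..r.
        (w i * w j * gaussian_density (\<mu> i) S z * gaussian_density (\<mu> j) S z) *\<^sub>R
        outer_product (\<mu> i) (\<mu> i - \<mu> j))
     /\<^sub>R (mixture_density r w \<mu> S z)\<^sup>2"

text \<open>Each component has logarithmic gradient \<open>matrix_inv S *v (\<mu> i - z)\<close>;
  averaging these with the posterior weights replaces \<open>\<mu> i\<close> by the posterior
  mean.\<close>

lemma mixture_density_has_derivative:
  assumes "covariance_matrix S" "mixture_weights r w"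
  shows "(mixture_density r w \<mu> S has_derivative
    (\<lambda>u. mixture_density r w \<mu> S z * ((mixture_mean r w \<mu> S z - z) \<bullet> (matrix_inv S *v u)))) (at z)"
proof -
  let ?P = "mixture_density r w \<mu> S z"
  let ?N = "\<lambda>i. gaussian_density (\<mu> i) S z"
  have "(mixture_density r w \<mu> S has_derivative
      (\<lambda>u. \<Sum>i=1..r. w i * (?N i * ((\<mu> i - z) \<bullet> (matrix_inv S *v u))))) (at z)"
    unfolding mixture_density_def
    by (intro has_derivative_sum has_derivative_mult_right gaussian_density_has_derivative assms)
  moreover have "(\<Sum>i=1..r. w i * (?N i * ((\<mu> i - z) \<bullet> v))) = ?P * ((mixture_mean r w \<mu> S z - z) \<bullet> v)" for v
  proof -
    have "?P *\<^sub>R mixture_mean r w \<mu> S z = (\<Sum>i=1..r. (w i * ?N i) *\<^sub>R \<mu> i)"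
      using mixture_density_nonzero[OF assms] by (simp add: mixture_mean_def)
    then have "?P * (mixture_mean r w \<mu> S z \<bullet> v) = (\<Sum>i=1..r. (w i * ?N i) *\<^sub>R \<mu> i) \<bullet> v"
      by (metis inner_scaleR_left)
    then show ?thesis
      by (simp add: mixture_density_def inner_sum_left inner_diff_left right_diff_distrib
          sum_subtractf sum_distrib_right mult.assoc)
  qed
  ultimately show ?thesis by simp
qed

lemma outer_product_mult_vector: "outer_product u v *v x = (v \<bullet> x) *\<^sub>R u"
  by (simp add: vec_eq_iff outer_product_def matrix_vector_mult_def inner_vec_def
      sum_distrib_left sum_distrib_right ac_simps)

lemma matrix_vector_sum_left: "(\<Sum>i\<in>I. M i) *v x = (\<Sum>i\<in>I. M i *v (x :: real^'n))"
  by (induction I rule: infinite_finite_induct) (simp_all add: matrix_vector_mult_add_rdistrib)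

text \<open>The terms are grouped by the vector \<open>\<mu> i\<close> so that its coefficient is
  the derivative of the posterior weight of component \<open>i\<close>.\<close>

lemma mixture_covariance_mult_vector:
  "mixture_covariance r w \<mu> S z *v x =
     (\<Sum>i=1..r. (\<Sum>j=1..r. w i * gaussian_density (\<mu> i) S z * (w j * gaussian_density (\<mu> j) S z) *
        ((\<mu> i - \<mu> j) \<bullet> x) / (mixture_density r w \<mu> S z)\<^sup>2) *\<^sub>R \<mu> i)"
  by (simp add: mixture_covariance_def matrix_vector_sum_left scaleR_matrix_vector_assoc[symmetric]
      outer_product_mult_vector scaleR_sum_right scaleR_sum_left divide_inverse ac_simps)

text \<open>The quotient rule differentiates the posterior weights, and summing against the centres
  gives the covariance. For normalized weights its double sum is the mean of
  \<open>outer_product (\<mu> i) (\<mu> i)\<close> minus the outer square of the posterior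
  mean.\<close>

lemma mixture_mean_has_derivative:
  assumes "covariance_matrix S" "mixture_weights r w"
  shows "(mixture_mean r w \<mu> S has_derivative
    (\<lambda>u. mixture_covariance r w \<mu> S z *v (matrix_inv S *v u))) (at z)"
proof -
  let ?P = "mixture_density r w \<mu> S"
  let ?N = "\<lambda>i. gaussian_density (\<mu> i) S"
  let ?M = "matrix_inv S"
  have P: "?P z \<noteq> 0"
    by (rule mixture_density_nonzero[OF assms])
  have quot: "((\<lambda>z. w i * ?N i z / ?P z) has_derivative
      (\<lambda>u. \<Sum>j=1..r. w i * ?N i z * (w j * ?N j z) * ((\<mu> i - \<mu> j) \<bullet> (?M *v u)) / (?P z)\<^sup>2)) (at z)" for i
  proof -
    have "((\<lambda>z. w i * ?N i z / ?P z) has_derivative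
      (\<lambda>u. (w i * (?N i z * ((\<mu> i - z) \<bullet> (?M *v u))) * ?P z
           - w i * ?N i z * (\<Sum>j=1..r. w j * (?N j z * ((\<mu> j - z) \<bullet> (?M *v u))))) / (?P z * ?P z))) (at z)"
      unfolding mixture_density_def
      by (rule has_derivative_divide')
        (use P in \<open>auto intro!: has_derivative_sum has_derivative_mult_right
          gaussian_density_has_derivative assms simp: mixture_density_def\<close>)
    \<comment> \<open>Expanding the density as a sum over \<open>j\<close> pairs the differences
      \<open>\<mu> i - z\<close> and \<open>\<mu> j - z\<close>, so \<open>z\<close>
      cancels.\<close>
    moreover have "w i * (?N i z * ((\<mu> i - z) \<bullet> v)) * ?P z
           - w i * ?N i z * (\<Sum>j=1..r. w j * (?N j z * ((\<mu> j - z) \<bullet> v)))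
        = (\<Sum>j=1..r. w i * ?N i z * (w j * ?N j z) * ((\<mu> i - \<mu> j) \<bullet> v))" for v
      unfolding mixture_density_def
      by (simp add: sum_distrib_left sum_subtractf[symmetric] inner_diff_left algebra_simps)
    ultimately show ?thesis
      by (simp add: sum_divide_distrib power2_eq_square)
  qed
  have "mixture_mean r w \<mu> S = (\<lambda>z. \<Sum>i=1..r. (w i * ?N i z / ?P z) *\<^sub>R \<mu> i)"
    by (simp add: fun_eq_iff mixture_mean_def scaleR_sum_right divide_inverse mult.commute)
  then show ?thesis
    unfolding mixture_covariance_mult_vector
    by (simp only:) (intro has_derivative_sum has_derivative_scaleR_left quot)
qed

section \<open>Second-order comparison of two mixtures\<close>

text \<open>Multiplication by fixed matrices on both sides is linear; this turns a sandwiched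
  covariance into the double sums of the theorem.\<close>

lemma sum_matrix_sandwich:
  fixes X :: "real^'n^'m" and Y :: "real^'k^'l"
  shows "X ** ((\<Sum>i\<in>I. \<Sum>j\<in>J. c i j *\<^sub>R M i j) /\<^sub>R s) ** Y
     = (\<Sum>i\<in>I. \<Sum>j\<in>J. c i j *\<^sub>R (X ** M i j ** Y)) /\<^sub>R s"
proof -
  have lin: "linear (\<lambda>M. X ** M ** Y)"
    by (intro linearI)
      (simp_all add: matrix_eq matrix_vector_mul_assoc[symmetric] scaleR_matrix_vector_assoc[symmetric]
        matrix_vector_mult_add_rdistrib matrix_vector_right_distrib matrix_vector_mult_scaleR)
  show ?thesis
    by (simp only: linear_sum[OF lin] linear_cmul[OF lin])
qed

text \<open>Instead of taking logarithms, the identity is differentiated and divided by the density,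
  which removes \<open>c\<close> and equates the scores; differentiating the scores equates the
  Hessians.\<close>

lemma affine_mixtures_hessian:
  fixes A :: "real^'d^'d"
  assumes cov: "covariance_matrix Sp" "covariance_matrix Sq"
    and weights: "mixture_weights rp wp" "mixture_weights rq wq"
    and "open \<Gamma>"
    and eq: "\<And>z. z \<in> \<Gamma> \<Longrightarrow> mixture_density rp wp \<mu>p Sp (A *v z + b) = c * mixture_density rq wq \<mu>q Sq z"
    and "z \<in> \<Gamma>"
  shows "transpose A ** matrix_inv Sp ** mixture_covariance rp wp \<mu>p Sp (A *v z + b) ** matrix_inv Sp ** A
      - matrix_inv Sq ** mixture_covariance rq wq \<mu>q Sq z ** matrix_inv Sq
    = transpose A ** matrix_inv Sp ** A - matrix_inv Sq" (is "?lhs = ?rhs")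
proof -
  let ?Mp = "matrix_inv Sp" and ?Mq = "matrix_inv Sq"
  let ?mp = "mixture_mean rp wp \<mu>p Sp" and ?mq = "mixture_mean rq wq \<mu>q Sq"
  have aff: "((\<lambda>z. A *v z + b) has_derivative (\<lambda>u. A *v u)) (at z)" for z
    using bounded_linear_imp_has_derivative[OF matrix_vector_mul_bounded_linear, of A]
    by (intro has_derivative_add_const)
  have score: "transpose A *v (?Mp *v (?mp (A *v z + b) - (A *v z + b))) = ?Mq *v (?mq z - z)"
    if z: "z \<in> \<Gamma>" for z
  proof -
    let ?p = "mixture_density rp wp \<mu>p Sp (A *v z + b)" and ?q = "mixture_density rq wq \<mu>q Sq z"
    let ?gp = "?mp (A *v z + b) - (A *v z + b)" and ?gq = "?mq z - z"
    have "((\<lambda>z. mixture_density rp wp \<mu>p Sp (A *v z + b)) has_derivative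
        (\<lambda>u. ?p * (?gp \<bullet> (?Mp *v (A *v u))))) (at z)"
      by (rule has_derivative_compose[OF aff mixture_density_has_derivative[OF cov(1) weights(1)]])
    then have d1: "((\<lambda>z. c * mixture_density rq wq \<mu>q Sq z) has_derivative
        (\<lambda>u. ?p * (?gp \<bullet> (?Mp *v (A *v u))))) (at z)"
      by (rule has_derivative_transform_within_open[OF _ \<open>open \<Gamma>\<close> z eq])
    have d2: "((\<lambda>z. c * mixture_density rq wq \<mu>q Sq z) has_derivative
        (\<lambda>u. c * (?q * (?gq \<bullet> (?Mq *v u))))) (at z)"
      by (intro has_derivative_mult_right mixture_density_has_derivative cov weights)
    \<comment> \<open>By the density identity \<open>c * ?q\<close> is \<open>?p\<close>, so both
      derivatives carry the same nonzero factor.\<close>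
    have "?p * (?gp \<bullet> (?Mp *v (A *v u))) = ?p * (?gq \<bullet> (?Mq *v u))" for u
      using fun_cong[OF has_derivative_unique[OF d1 d2], of u] eq[OF z] by simp
    then have "?gp \<bullet> (?Mp *v (A *v u)) = ?gq \<bullet> (?Mq *v u)" for u
      using mixture_density_nonzero[OF cov(1) weights(1)] by simp
    then have "(?Mp *v ?gp) \<bullet> (A *v u) = (?Mq *v ?gq) \<bullet> u" for u
      by (simp add: inner_matrix_symmetric[OF covariance_matrix_imp_transpose_inv] cov)
    then have "(transpose A *v (?Mp *v ?gp)) \<bullet> u = (?Mq *v ?gq) \<bullet> u" for u
      by (metis dot_lmul_matrix transpose_matrix_vector)
    then show ?thesis
      by (metis vector_eq_rdot)
  qed
  have "((\<lambda>z. transpose A *v (?Mp *v (?mp (A *v z + b) - (A *v z + b)))) has_derivative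
      (\<lambda>u. transpose A *v (?Mp *v (mixture_covariance rp wp \<mu>p Sp (A *v z + b) *v (?Mp *v (A *v u)) - A *v u)))) (at z)"
    by (intro bounded_linear.has_derivative[OF matrix_vector_mul_bounded_linear] has_derivative_diff aff
        has_derivative_compose[OF aff mixture_mean_has_derivative[OF cov(1) weights(1)]])
  then have d1: "((\<lambda>z. ?Mq *v (?mq z - z)) has_derivative
      (\<lambda>u. transpose A *v (?Mp *v (mixture_covariance rp wp \<mu>p Sp (A *v z + b) *v (?Mp *v (A *v u)) - A *v u)))) (at z)"
    by (rule has_derivative_transform_within_open[OF _ \<open>open \<Gamma>\<close> \<open>z \<in> \<Gamma>\<close> score])
  have d2: "((\<lambda>z. ?Mq *v (?mq z - z)) has_derivative
      (\<lambda>u. ?Mq *v (mixture_covariance rq wq \<mu>q Sq z *v (?Mq *v u) - u))) (at z)"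
    by (intro bounded_linear.has_derivative[OF matrix_vector_mul_bounded_linear] has_derivative_diff
        has_derivative_ident mixture_mean_has_derivative cov weights)
  have eq: "transpose A *v (?Mp *v (mixture_covariance rp wp \<mu>p Sp (A *v z + b) *v (?Mp *v (A *v u)) - A *v u))
      = ?Mq *v (mixture_covariance rq wq \<mu>q Sq z *v (?Mq *v u) - u)" for u
    by (rule fun_cong[OF has_derivative_unique[OF d1 d2]])
  \<comment> \<open>Moves both covariance terms to the left and both constant terms to the
    right.\<close>
  have swap: "x - y = v - w" if "x - v = y - w" for x y v w :: "real^'d"
    using that by (metis add_diff_cancel_left' diff_add_cancel diff_diff_eq2 diff_diff_add add.commute)
  show ?thesis
    unfolding matrix_eq
  proof
    fix u
    from eq[of u] show "?lhs *v u = ?rhs *v u"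
      unfolding matrix_vector_mult_diff_rdistrib matrix_vector_mul_assoc[symmetric] matrix_vector_mult_diff_distrib
      by (rule swap)
  qed
qed

section \<open>Transfer of the density identity along the flow\<close>

theorem corollaryA5p1:
  fixes \<Sigma>\<^sub>p \<Sigma>\<^sub>q :: "real^'d^'d"
    and \<mu>\<^sub>p \<mu>\<^sub>q :: "nat \<Rightarrow> real^'d"
    and w\<^sub>p w\<^sub>q :: "nat \<Rightarrow> real"
    and r\<^sub>p r\<^sub>q :: nat
    and p q :: "real^'d \<Rightarrow> real"
    and f :: "real^'d \<Rightarrow> real^'d"
    and fs :: "(real^'d \<Rightarrow> real^'d) list"
  assumes "CARD('d) > 1"
    and "covariance_matrix \<Sigma>\<^sub>p" and "covariance_matrix \<Sigma>\<^sub>q"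
    and "mixture_weights r\<^sub>p w\<^sub>p" and "mixture_weights r\<^sub>q w\<^sub>q"
    and "p = mixture_density r\<^sub>p w\<^sub>p \<mu>\<^sub>p \<Sigma>\<^sub>p"
    and "q = mixture_density r\<^sub>q w\<^sub>q \<mu>\<^sub>q \<Sigma>\<^sub>q"
    and "\<forall>g\<in>set fs. relu_sylvester_flow g"
    and "f = foldr (\<circ>) fs id"
    and "AE x in lborel. p x = pushforward_density f q x"
  shows "AE x in lborel. \<exists>\<Gamma>. open \<Gamma> \<and> x \<in> \<Gamma> \<and>
    (\<exists>(A :: real^'d^'d) (b :: real^'d).
      (\<lambda>z.
        (\<Sum>i=1..r\<^sub>p. \<Sum>j=1..r\<^sub>p.
            (w\<^sub>p i * w\<^sub>p j * gaussian_density (\<mu>\<^sub>p i) \<Sigma>\<^sub>p (A *v z + b)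
                         * gaussian_density (\<mu>\<^sub>p j) \<Sigma>\<^sub>p (A *v z + b)) *\<^sub>R
            (transpose A ** matrix_inv \<Sigma>\<^sub>p ** outer_product (\<mu>\<^sub>p i) (\<mu>\<^sub>p i - \<mu>\<^sub>p j)
                         ** matrix_inv \<Sigma>\<^sub>p ** A))
          /\<^sub>R (\<Sum>j=1..r\<^sub>p. w\<^sub>p j * gaussian_density (\<mu>\<^sub>p j) \<Sigma>\<^sub>p (A *v z + b))\<^sup>2
        - (\<Sum>i=1..r\<^sub>q. \<Sum>j=1..r\<^sub>q.
            (w\<^sub>q i * w\<^sub>q j * gaussian_density (\<mu>\<^sub>q i) \<Sigma>\<^sub>q z * gaussian_density (\<mu>\<^sub>q j) \<Sigma>\<^sub>q z) *\<^sub>R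
            (matrix_inv \<Sigma>\<^sub>q ** outer_product (\<mu>\<^sub>q i) (\<mu>\<^sub>q i - \<mu>\<^sub>q j) ** matrix_inv \<Sigma>\<^sub>q))
          /\<^sub>R (\<Sum>j=1..r\<^sub>q. w\<^sub>q j * gaussian_density (\<mu>\<^sub>q j) \<Sigma>\<^sub>q z)\<^sup>2)
      constant_on \<Gamma>)"
proof -
  note cov = assms(2,3) and weights = assms(4,5) and p = assms(6) and q = assms(7)
  have bij: "bij f" and aff: "AE x in lborel. affine_near f x"
    using relu_sylvester_flows_bij_affine_near[OF assms(8)] unfolding assms(9) by blast+
  define N where "N = {x. p x \<noteq> pushforward_density f q x}"
  \<comment> \<open>The density identity is needed at the image points \<open>f z\<close>, so its
    exceptional set is pulled back through \<open>f\<close>.\<close>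
  have N: "negligible (f -` N)"
    using negligible_vimage_affine_near[OF bij_is_inj[OF bij] aff]
      assms(10)[unfolded AE_lborel_iff_negligible] unfolding N_def .
  show ?thesis (is "AE x in lborel. ?P x")
    using aff
  proof (rule eventually_mono)
    fix x assume "affine_near f x"
    then obtain A b \<Gamma> where \<Gamma>: "open \<Gamma>" "x \<in> \<Gamma>" and f: "\<forall>z\<in>\<Gamma>. f z = A *v z + b"
      unfolding affine_near_def by (elim exE conjE)
    have jac: "jacobian f (at z) = A" if "z \<in> \<Gamma>" for z
    proof -
      have "((\<lambda>z. A *v z + b) has_derivative (\<lambda>u. A *v u)) (at z)"
        by (intro has_derivative_add_const bounded_linear_imp_has_derivative
            matrix_vector_mul_bounded_linear)
      then have "(f has_derivative (\<lambda>u. A *v u)) (at z)"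
        by (rule has_derivative_transform_within_open[OF _ \<Gamma>(1) that]) (simp add: f)
      then show ?thesis
        unfolding jacobian_def by (simp add: frechet_derivative_at[symmetric])
    qed
    \<comment> \<open>On \<Gamma> the Jacobian is constantly \<open>A\<close>, so the identity holds
      off a null set; continuity of both sides extends it to all of \<Gamma>.\<close>
    have p_eq: "p (A *v z + b) = inverse \<bar>det A\<bar> * q z" if "z \<in> \<Gamma>" for z
    proof (rule continuous_eq_off_negligible[OF \<Gamma>(1) _ _ _ that])
      have contp: "continuous_on UNIV p" and contq: "continuous_on UNIV q"
        unfolding p q
        using mixture_density_has_derivative[OF cov(1) weights(1)]
          mixture_density_has_derivative[OF cov(2) weights(2)]
        by (meson continuous_at_imp_continuous_on has_derivative_continuous)+
      have "continuous_on \<Gamma> (\<lambda>z. A *v z + b)"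
        by (intro continuous_intros linear_continuous_on matrix_vector_mul_bounded_linear)
      then show "continuous_on \<Gamma> (\<lambda>z. p (A *v z + b))"
        by (rule continuous_on_compose2[OF contp]) simp
      show "continuous_on \<Gamma> (\<lambda>z. inverse \<bar>det A\<bar> * q z)"
        by (intro continuous_on_mult_left continuous_on_subset[OF contq]) simp
      have "{z \<in> \<Gamma>. p (A *v z + b) \<noteq> inverse \<bar>det A\<bar> * q z} \<subseteq> f -` N"
        using f jac by (auto simp: N_def pushforward_density_def inv_f_f[OF bij_is_inj[OF bij]]
            divide_inverse mult.commute)
      with N show "negligible {z \<in> \<Gamma>. p (A *v z + b) \<noteq> inverse \<bar>det A\<bar> * q z}"
        by (rule negligible_subset)
    qed
    have p_term: "transpose A ** matrix_inv \<Sigma>\<^sub>p ** mixture_covariance r\<^sub>p w\<^sub>p \<mu>\<^sub>p \<Sigma>\<^sub>p y ** matrix_inv \<Sigma>\<^sub>p ** A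
        = (\<Sum>i=1..r\<^sub>p. \<Sum>j=1..r\<^sub>p.
            (w\<^sub>p i * w\<^sub>p j * gaussian_density (\<mu>\<^sub>p i) \<Sigma>\<^sub>p y * gaussian_density (\<mu>\<^sub>p j) \<Sigma>\<^sub>p y) *\<^sub>R
            (transpose A ** matrix_inv \<Sigma>\<^sub>p ** outer_product (\<mu>\<^sub>p i) (\<mu>\<^sub>p i - \<mu>\<^sub>p j)
                         ** matrix_inv \<Sigma>\<^sub>p ** A))
          /\<^sub>R (\<Sum>j=1..r\<^sub>p. w\<^sub>p j * gaussian_density (\<mu>\<^sub>p j) \<Sigma>\<^sub>p y)\<^sup>2" for y
      unfolding mixture_covariance_def mixture_density_def
      \<comment> \<open>The five-fold product is read as a three-fold one for the sandwich;
        \<open>matrix_mul_assoc\<close> restores the left-nested form.\<close>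
      by (rule sum_matrix_sandwich[where X = "transpose A ** matrix_inv \<Sigma>\<^sub>p"
            and Y = "matrix_inv \<Sigma>\<^sub>p ** A", unfolded matrix_mul_assoc])
    have q_term: "matrix_inv \<Sigma>\<^sub>q ** mixture_covariance r\<^sub>q w\<^sub>q \<mu>\<^sub>q \<Sigma>\<^sub>q z ** matrix_inv \<Sigma>\<^sub>q
        = (\<Sum>i=1..r\<^sub>q. \<Sum>j=1..r\<^sub>q.
            (w\<^sub>q i * w\<^sub>q j * gaussian_density (\<mu>\<^sub>q i) \<Sigma>\<^sub>q z * gaussian_density (\<mu>\<^sub>q j) \<Sigma>\<^sub>q z) *\<^sub>R
            (matrix_inv \<Sigma>\<^sub>q ** outer_product (\<mu>\<^sub>q i) (\<mu>\<^sub>q i - \<mu>\<^sub>q j) ** matrix_inv \<Sigma>\<^sub>q))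
          /\<^sub>R (\<Sum>j=1..r\<^sub>q. w\<^sub>q j * gaussian_density (\<mu>\<^sub>q j) \<Sigma>\<^sub>q z)\<^sup>2" for z
      unfolding mixture_covariance_def mixture_density_def by (rule sum_matrix_sandwich)
    have "transpose A ** matrix_inv \<Sigma>\<^sub>p ** mixture_covariance r\<^sub>p w\<^sub>p \<mu>\<^sub>p \<Sigma>\<^sub>p (A *v z + b) ** matrix_inv \<Sigma>\<^sub>p ** A
        - matrix_inv \<Sigma>\<^sub>q ** mixture_covariance r\<^sub>q w\<^sub>q \<mu>\<^sub>q \<Sigma>\<^sub>q z ** matrix_inv \<Sigma>\<^sub>q
      = transpose A ** matrix_inv \<Sigma>\<^sub>p ** A - matrix_inv \<Sigma>\<^sub>q" if "z \<in> \<Gamma>" for z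
      by (rule affine_mixtures_hessian[OF cov weights \<Gamma>(1) p_eq[unfolded p q] that])
    \<comment> \<open>The constant value is the right-hand side of the preceding equation, which
      does not involve \<open>z\<close>.\<close>
    then show "?P x"
      unfolding constant_on_def p_term q_term
      using \<Gamma> by (intro exI[of _ \<Gamma>] exI[of _ A] exI[of _ b] conjI exI ballI)
  qed
qed

end
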